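(* The permutation class $\mathrm{Av}(1423, 1342)$ is splittable.
   Context: A permutation of length $n\ge 1$ is a sequence of all the $n$ distinct numbers of $[n]=\{1,\dots,n\}$. Two sequences of distinct numbers of the same length are order-isomorphic if their elements are in the same relative order. A permutation $\pi$ contains $\sigma$ if some subsequence of $\pi$ is order-isomorphic to $\sigma$; otherwise $\pi$ avoids $\sigma$. $\mathrm{Av}(\sigma,\rho,\dots)$ is the set of all permutations avoiding all of $\sigma,\rho,\dots$. A permutation class is a set of permutations closed under taking contained permutations. For permutation classes $A$ and $B$, $A\odot B$ is the class of all merges of a (possibly empty) permutation from $A$ with a (possibly empty) permutation from $B$: that is, $\pi\in A\odot B$ if the elements of $\pi$ can be partitioned into two disjoint subsequences such that the first is empty or order-isomorphic to a member of $A$, and the second is empty or order-isomorphic to a member of $B$. A multiset $\{P_1,\dots,P_m\}$ of permutation classes is a splitting of a permutation class $C$ if $C\subseteq P_1\odot\cdots\odot P_m$; it is nontrivial if no $P_i$ is a superset of $C$. $C$ is splittable if it admits a nontrivial splitting. *)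

theory Defs
  imports "HOL-Library.Sublist" "HOL-Library.Multiset"
begin

definition is_perm :: "nat list \<Rightarrow> bool" where
  "is_perm p \<longleftrightarrow> length p \<ge> 1 \<and> distinct p \<and> set p = {1..length p}"

(* Intended for sequences of distinct numbers. *)
definition order_iso :: "nat list \<Rightarrow> nat list \<Rightarrow> bool" where
  "order_iso xs ys \<longleftrightarrow> length xs = length ys \<and>
     (\<forall>i < length xs. \<forall>j < length xs. xs ! i < xs ! j \<longleftrightarrow> ys ! i < ys ! j)"

definition contains :: "nat list \<Rightarrow> nat list \<Rightarrow> bool" where
  "contains p s \<longleftrightarrow> (\<exists>xs. subseq xs p \<and> order_iso xs s)"

definition Av :: "nat list set \<Rightarrow> nat list set" where
  "Av B = {p. is_perm p \<and> (\<forall>s\<in>B. \<not> contains p s)}"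

definition perm_class :: "nat list set \<Rightarrow> bool" where
  "perm_class C \<longleftrightarrow> (\<forall>p\<in>C. is_perm p) \<and>
     (\<forall>p\<in>C. \<forall>s. is_perm s \<and> contains p s \<longrightarrow> s \<in> C)"

(* shuffles xs ys is the set of all interleavings of xs and ys, so membership of p says that
   the positions of p are partitioned into two sets, carrying the subsequences xs and ys. *)
definition class_merge :: "nat list set \<Rightarrow> nat list set \<Rightarrow> nat list set" (infixr "\<odot>" 70) where
  "A \<odot> B = {p. is_perm p \<and> (\<exists>xs ys. p \<in> shuffles xs ys \<and>
     (xs = [] \<or> (\<exists>a\<in>A. order_iso xs a)) \<and>
     (ys = [] \<or> (\<exists>b\<in>B. order_iso ys b)))}"

fun merge_list :: "nat list set list \<Rightarrow> nat list set" where
  "merge_list [] = {}"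
| "merge_list [P] = P"
| "merge_list (P # Q # Ps) = P \<odot> merge_list (Q # Ps)"

(* On permutation classes the merge is commutative and associative, so neither the chosen
   enumeration Ps of the multiset nor the bracketing in merge_list matters. *)
definition splitting :: "nat list set multiset \<Rightarrow> nat list set \<Rightarrow> bool" where
  "splitting M C \<longleftrightarrow> perm_class C \<and> M \<noteq> {#} \<and> (\<forall>P \<in># M. perm_class P) \<and>
     (\<exists>Ps. mset Ps = M \<and> C \<subseteq> merge_list Ps)"

definition nontrivial_splitting :: "nat list set multiset \<Rightarrow> nat list set \<Rightarrow> bool" where
  "nontrivial_splitting M C \<longleftrightarrow> splitting M C \<and> (\<forall>P \<in># M. \<not> C \<subseteq> P)"

definition splittable :: "nat list set \<Rightarrow> bool" where
  "splittable C \<longleftrightarrow> (\<exists>M. nontrivial_splitting M C)"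

end

theory Submission
  imports Defs
begin

text \<open>
  A permutation avoids 1423 and 1342 exactly when the points above and to the right of any of its
  points form a layered permutation, that is, one in which incomparability (equality or forming a
  descent) is transitive. Let \<open>C\<close> be this class. The pattern \<open>\<tau>\<close> = 463152 lies in \<open>C\<close>, and every member
  of \<open>C\<close> can be 2-coloured without a monochromatic copy of \<open>\<tau>\<close>, so \<open>C\<close> is covered by the merge of
  two copies of its proper subclass of \<open>\<tau>\<close>-avoiders.

  The colouring is built by induction on the number of points, and for this the condition is
  strengthened: in a copy of \<open>\<tau>\<close> the points playing 6, 5, 2 must not get one common colour while each
  of the points playing 4, 3, 1 has that colour or is a left-to-right minimum of the whole
  permutation (\<open>bad_copy\<close>). Minima thus count as having both colours.

  If the permutation avoids 123, cut the decreasing sequence of non-minima greedily into groups whose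
  members lie above a common minimum, and colour the groups alternately
  (\<open>ex_grouping\<close>, \<open>ex_colouring_no123\<close>). Two points above a common minimum lie in the same or in
  neighbouring groups, so the points 6, 5, 2 of a bad copy would share a group, hence a minimum \<open>q\<close>
  below all of them. Such a \<open>q\<close> also lies below the point playing 3, and \<open>q\<close>, 3, 5 form a 123.

  If there is a 123, the permutation has a nontrivial proper interval with nothing below and to the
  left of it (\<open>ex_minimal_interval\<close>). Colour the interval and the permutation obtained by shrinking it
  to one of its minima separately. As \<open>\<tau>\<close> is simple, a bad copy lies inside the interval or meets it
  in at most one point; such a point plays 4, 3 or 1, so it can be replaced by the remaining minimum,
  and either way one of the two smaller colourings had a bad copy (\<open>no_bad_copy_glue\<close>).
\<close>

section \<open>Points in the plane\<close>

text \<open>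
  The coordinates are parameters, so that exchanging position and value (inverting the permutation)
  is an interpretation of the same locale. The set of points is an explicit argument of the notions
  below because the induction passes to subsets.
\<close>

locale plane =
  fixes p :: "'a \<Rightarrow> 'b::linorder" and v :: "'a \<Rightarrow> 'c::linorder"
begin

definition below :: "'a \<Rightarrow> 'a \<Rightarrow> bool" (infix "\<sqsubset>" 50) where
  "a \<sqsubset> b \<longleftrightarrow> p a < p b \<and> v a < v b"

definition incomparable :: "'a \<Rightarrow> 'a \<Rightarrow> bool" (infix "\<asymp>" 50) where
  "a \<asymp> b \<longleftrightarrow> \<not> a \<sqsubset> b \<and> \<not> b \<sqsubset> a"

definition generic :: "'a set \<Rightarrow> bool" where
  "generic S \<longleftrightarrow> finite S \<and> inj_on p S \<and> inj_on v S"

definition minimal :: "'a set \<Rightarrow> 'a \<Rightarrow> bool" where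
  "minimal S m \<longleftrightarrow> m \<in> S \<and> (\<forall>u\<in>S. \<not> u \<sqsubset> m)"

definition layered_quadrants :: "'a set \<Rightarrow> bool" where
  "layered_quadrants S \<longleftrightarrow> (\<forall>x\<in>S. \<forall>a\<in>S. \<forall>b\<in>S. \<forall>c\<in>S.
     x \<sqsubset> a \<and> x \<sqsubset> b \<and> x \<sqsubset> c \<and> a \<asymp> b \<and> b \<asymp> c \<longrightarrow> a \<asymp> c)"

definition interval :: "'a set \<Rightarrow> 'a set \<Rightarrow> bool" where
  "interval S I \<longleftrightarrow> I \<subseteq> S \<and> (\<forall>a\<in>I. \<forall>b\<in>I. \<forall>w\<in>S.
     p a < p w \<and> p w < p b \<or> v a < v w \<and> v w < v b \<longrightarrow> w \<in> I)"

lemma intervalD: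
  "interval S I \<Longrightarrow> a \<in> I \<Longrightarrow> b \<in> I \<Longrightarrow> w \<in> S \<Longrightarrow>
   p a < p w \<and> p w < p b \<or> v a < v w \<and> v w < v b \<Longrightarrow> w \<in> I"
  unfolding interval_def by blast

lemma interval_subset: "interval S I \<Longrightarrow> I \<subseteq> S"
  unfolding interval_def by blast

lemma generic_subset: "generic S \<Longrightarrow> T \<subseteq> S \<Longrightarrow> generic T"
  unfolding generic_def by (meson finite_subset inj_on_subset)

lemma layered_quadrants_subset: "layered_quadrants S \<Longrightarrow> T \<subseteq> S \<Longrightarrow> layered_quadrants T"
  unfolding layered_quadrants_def by (meson subsetD)

lemma layered_quadrantsD:
  "layered_quadrants S \<Longrightarrow> x \<in> S \<Longrightarrow> a \<in> S \<Longrightarrow> b \<in> S \<Longrightarrow> c \<in> S \<Longrightarrow>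
   x \<sqsubset> a \<Longrightarrow> x \<sqsubset> b \<Longrightarrow> x \<sqsubset> c \<Longrightarrow> a \<asymp> b \<Longrightarrow> b \<asymp> c \<Longrightarrow> a \<asymp> c"
  unfolding layered_quadrants_def by blast

lemma generic_less_cases:
  assumes "generic S" "a \<in> S" "b \<in> S" "a \<noteq> b"
  shows "p a < p b \<or> p b < p a" "v a < v b \<or> v b < v a"
  using assms unfolding generic_def inj_on_def by (meson neq_iff)+

lemma interval_same_side:
  assumes S: "generic S" "interval S I" and w: "a \<in> I" "b \<in> I" "w \<in> S" "w \<notin> I"
  shows "p a < p w \<Longrightarrow> p b < p w" "p w < p a \<Longrightarrow> p w < p b"
    "v a < v w \<Longrightarrow> v b < v w" "v w < v a \<Longrightarrow> v w < v b"
proof -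
  have "b \<in> S" "b \<noteq> w" using interval_subset[OF S(2)] w by blast+
  note b = generic_less_cases[OF S(1) this(1) w(3) this(2)]
  have P: "\<not> (p c < p w \<and> p w < p d)" and V: "\<not> (v c < v w \<and> v w < v d)"
    if "c \<in> I" "d \<in> I" for c d
    using intervalD[OF S(2) that w(3)] w(4) by blast+
  show "p a < p w \<Longrightarrow> p b < p w" using P[OF w(1,2)] b(1) by blast
  show "p w < p a \<Longrightarrow> p w < p b" using P[OF w(2,1)] b(1) by blast
  show "v a < v w \<Longrightarrow> v b < v w" using V[OF w(1,2)] b(2) by blast
  show "v w < v a \<Longrightarrow> v w < v b" using V[OF w(2,1)] b(2) by blast
qed

lemma below_trans: "a \<sqsubset> b \<Longrightarrow> b \<sqsubset> c \<Longrightarrow> a \<sqsubset> c"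
  unfolding below_def by (meson less_trans)

lemma ex_leftmost:
  assumes "finite Y" "Y \<noteq> {}"
  obtains y where "y \<in> Y" "\<And>y'. y' \<in> Y \<Longrightarrow> p y \<le> p y'"
  using ex_is_arg_min_if_finite[OF assms, of p] unfolding is_arg_min_linorder by blast

lemma ex_rightmost:
  assumes "finite Y" "Y \<noteq> {}"
  obtains y where "y \<in> Y" "\<And>y'. y' \<in> Y \<Longrightarrow> p y' \<le> p y"
proof -
  have "Max (p ` Y) \<in> p ` Y" using assms by simp
  then obtain y where "y \<in> Y" "p y = Max (p ` Y)" by auto
  thus thesis using that[of y] assms(1) by simp
qed

lemma ex_minimal_below:
  assumes "finite S" "u \<in> S"
  shows "\<exists>m. minimal S m \<and> (m = u \<or> m \<sqsubset> u)"
proof -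
  let ?D = "{a \<in> S. a = u \<or> a \<sqsubset> u}"
  have "finite ?D" "?D \<noteq> {}" using assms by auto
  then obtain m where m: "is_arg_min p (\<lambda>a. a \<in> ?D) m"
    using ex_is_arg_min_if_finite[of ?D p] by blast
  have "\<not> w \<sqsubset> m" if "w \<in> S" for w
  proof
    assume "w \<sqsubset> m"
    moreover from this have "w \<in> ?D" using m that below_trans unfolding is_arg_min_def by blast
    ultimately show False using m unfolding is_arg_min_def below_def by blast
  qed
  thus ?thesis using m unfolding is_arg_min_def minimal_def by blast
qed

text \<open>
  Fix a point \<open>z\<close>. Among the points above a minimum \<open>m\<close> below \<open>z\<close>, those incomparable to \<open>z\<close> form the
  layer of \<open>z\<close>. Minima that see the same layer as \<open>x\<close> cannot be told apart by points outside their
  block, which makes the block an interval.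
\<close>

definition layer_above :: "'a set \<Rightarrow> 'a \<Rightarrow> 'a \<Rightarrow> 'a set" where
  "layer_above S z m = {l \<in> S. m \<sqsubset> l \<and> l \<asymp> z}"

definition twins :: "'a set \<Rightarrow> 'a \<Rightarrow> 'a \<Rightarrow> 'a set" where
  "twins S z x = {m. minimal S m \<and> m \<sqsubset> z \<and> layer_above S z m = layer_above S z x}"

definition twin_block :: "'a set \<Rightarrow> 'a \<Rightarrow> 'a \<Rightarrow> 'a set" where
  "twin_block S z x = {u \<in> S. u \<sqsubset> z \<and> (\<exists>m\<in>twins S z x. m = u \<or> m \<sqsubset> u)}"

text \<open>
  Let \<open>w\<close> be a point horizontally between two points \<open>g1\<close> and \<open>g2\<close> of the block, with twins \<open>m1\<close> and \<open>m2\<close>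
  below them. The point \<open>g2\<close> lies below the entire common layer. If \<open>w\<close> is above \<open>m1\<close>, then it is either
  below \<open>z\<close>, and so in the block, or in the layer, which is impossible as \<open>w\<close> is left of \<open>g2\<close>. If \<open>w\<close> is
  lower than \<open>m1\<close>, then a minimum below \<open>w\<close> sees the same layer, so it is a twin itself.
\<close>

lemma twin_block_position_convex:
  assumes S: "generic S" "layered_quadrants S" and z: "z \<in> S"
    and g: "g1 \<in> twin_block S z x" "g2 \<in> twin_block S z x"
    and w: "w \<in> S" "p g1 < p w" "p w < p g2"
  shows "w \<in> twin_block S z x"
proof (rule ccontr)
  assume wG: "w \<notin> twin_block S z x"
  let ?L = "layer_above S z x"
  obtain m1 where m1: "m1 \<in> twins S z x" "m1 = g1 \<or> m1 \<sqsubset> g1"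
    using g unfolding twin_block_def by blast
  obtain m2 where m2: "m2 \<in> twins S z x" "m2 = g2 \<or> m2 \<sqsubset> g2"
    using g unfolding twin_block_def by blast
  have g2: "g2 \<in> S" "g2 \<sqsubset> z" using g unfolding twin_block_def by auto
  have mS: "m1 \<in> S" "m2 \<in> S" "m1 \<sqsubset> z" "m2 \<sqsubset> z"
    using m1 m2 unfolding twins_def minimal_def by auto
  have L1: "layer_above S z m1 = ?L" and L2: "layer_above S z m2 = ?L"
    using m1 m2 unfolding twins_def by auto
  have pm1: "p m1 < p w" using m1 w unfolding below_def by force
  have wz: "p w < p z" using w g2 unfolding below_def by force
  have g2_below: "g2 \<sqsubset> l" if l: "l \<in> ?L" for l
  proof (cases "g2 = m2")
    case True
    thus ?thesis using l L2 unfolding layer_above_def by blast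
  next
    case False
    hence a: "m2 \<sqsubset> g2" using m2 by blast
    have b: "l \<in> S" "m2 \<sqsubset> l" "l \<asymp> z" using l L2 unfolding layer_above_def by auto
    have "\<not> g2 \<asymp> l"
      using layered_quadrantsD[OF S(2) mS(2) g2(1) b(1) z a b(2) mS(4) _ b(3)] g2(2)
      unfolding incomparable_def by blast
    moreover have "\<not> l \<sqsubset> g2" using b(3) g2(2) below_trans unfolding incomparable_def by blast
    ultimately show ?thesis unfolding incomparable_def by blast
  qed
  show False
  proof (cases "m1 \<sqsubset> w")
    case True
    have "\<not> w \<sqsubset> z" using wG w(1) m1(1) True unfolding twin_block_def by blast
    moreover have "\<not> z \<sqsubset> w" using wz unfolding below_def by auto
    ultimately have "w \<in> ?L" using L1 w(1) True unfolding layer_above_def incomparable_def by blast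
    from g2_below[OF this] show False using w(3) unfolding below_def by auto
  next
    case False
    have vw: "v w < v m1"
      using generic_less_cases(2)[OF S(1) w(1) mS(1)] pm1 False unfolding below_def by auto
    have w_z: "w \<sqsubset> z" using vw wz mS(3) unfolding below_def by (auto intro: less_trans)
    obtain n where n: "minimal S n" "n = w \<or> n \<sqsubset> w"
      using ex_minimal_below w(1) S(1) unfolding generic_def by blast
    have nS: "n \<in> S" using n unfolding minimal_def by blast
    have nz: "n \<sqsubset> z" using n w_z below_trans by blast
    have vn: "v n < v m1" and pn: "p n < p g2" using n(2) vw w(3) unfolding below_def by auto
    have pn1: "p m1 < p n"
      using generic_less_cases(1)[OF S(1) nS mS(1)] vn m1(1) nS
      unfolding twins_def minimal_def below_def by force
    have "layer_above S z n = ?L"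
    proof (intro subset_antisym subsetI)
      fix l assume l: "l \<in> ?L"
      have "v m1 < v l" "l \<in> S" "l \<asymp> z" using l L1 unfolding layer_above_def below_def by auto
      moreover have "p g2 < p l" using g2_below[OF l] unfolding below_def by simp
      ultimately show "l \<in> layer_above S z n"
        using vn pn unfolding layer_above_def below_def by auto
    next
      fix l assume "l \<in> layer_above S z n"
      hence l: "l \<in> S" "n \<sqsubset> l" "l \<asymp> z" unfolding layer_above_def by auto
      show "l \<in> ?L"
      proof (cases "m1 \<sqsubset> l \<or> m2 \<sqsubset> l")
        case True
        thus ?thesis using l L1 L2 unfolding layer_above_def by blast
      next
        case False
        \<comment> \<open>\<open>l\<close> is lower than \<open>m1\<close>, hence right of \<open>z\<close>; as it is not above
          \<open>m2\<close>, it is lower than \<open>g2\<close>, and \<open>g2, z, l\<close> form a 231 above \<open>n\<close>.\<close>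
        have "p m1 < p l" using pn1 l(2) unfolding below_def by auto
        hence vl: "v l < v m1"
          using generic_less_cases(2)[OF S(1) l(1) mS(1)] False unfolding below_def by auto
        hence "v l < v z" using mS(3) unfolding below_def by auto
        hence pl: "p z < p l"
          using generic_less_cases(1)[OF S(1) l(1) z] l(3) unfolding incomparable_def below_def by auto
        have "p m2 \<le> p g2" "v m2 \<le> v g2" "p g2 < p z"
          using m2(2) g2(2) unfolding below_def by auto
        hence vg: "v l \<le> v g2" using False pl unfolding below_def by force
        hence "n \<sqsubset> g2" using l(2) pn unfolding below_def by auto
        moreover have "g2 \<asymp> l" using vg pl g2(2) unfolding incomparable_def below_def by auto
        ultimately have "g2 \<asymp> z"
          using layered_quadrantsD[OF S(2) nS g2(1) l(1) z _ l(2) nz _ l(3)] by blast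
        thus ?thesis using g2(2) unfolding incomparable_def by blast
      qed
    qed
    hence "n \<in> twins S z x" using n(1) nz unfolding twins_def by blast
    hence "w \<in> twin_block S z x" using w(1) w_z n(2) unfolding twin_block_def by blast
    thus False using wG by blast
  qed
qed

end

text \<open>
  The class is closed under inverses and the block is defined symmetrically, so convexity in the
  values is convexity in the positions of the inverse.
\<close>

lemma (in plane) twin_block_interval:
  assumes S: "generic S" "layered_quadrants S" and z: "z \<in> S"
  shows "interval S (twin_block S z x)"
proof -
  interpret swapped: plane v p .
  have below: "swapped.below = below"
    by (intro ext) (simp add: swapped.below_def below_def conj_commute)
  have inc: "swapped.incomparable = incomparable"
    by (intro ext) (simp add: swapped.incomparable_def incomparable_def below)
  have block: "swapped.twin_block S z x = twin_block S z x"
    by (simp add: swapped.twin_block_def twin_block_def swapped.twins_def twins_def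
        swapped.layer_above_def layer_above_def swapped.minimal_def minimal_def below inc)
  have gen: "swapped.generic S"
    using S(1) unfolding swapped.generic_def generic_def by simp
  have lay: "swapped.layered_quadrants S"
    using S(2) unfolding swapped.layered_quadrants_def layered_quadrants_def below inc .
  show ?thesis unfolding interval_def
  proof (intro conjI ballI impI, goal_cases)
    case 1
    show ?case unfolding twin_block_def by blast
  next
    case (2 a b w)
    from 2(4) show ?case
    proof
      assume "p a < p w \<and> p w < p b"
      thus ?thesis using twin_block_position_convex[OF S z 2(1,2,3)] by blast
    next
      assume "v a < v w \<and> v w < v b"
      thus ?thesis
        using swapped.twin_block_position_convex[OF gen lay z, where x = x, unfolded block, OF 2(1,2,3)] by blast
    qed
  qed
qed

context plane
begin

text \<open>
  The block of a minimum \<open>m\<close> with \<open>m \<sqsubset> y \<sqsubset> z\<close> contains \<open>m\<close> and \<open>y\<close> but not \<open>z\<close>. A point outside an interval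
  is on the same side of all its points, so a point below some member would be below \<open>m\<close>.
\<close>

lemma ex_minimal_interval:
  assumes S: "generic S" "layered_quadrants S"
    and xyz: "x \<in> S" "y \<in> S" "z \<in> S" "x \<sqsubset> y" "y \<sqsubset> z"
  obtains I a b where "interval S I" "z \<notin> I" "a \<in> I" "b \<in> I" "a \<noteq> b"
    "\<And>u c. u \<in> S \<Longrightarrow> c \<in> I \<Longrightarrow> u \<sqsubset> c \<Longrightarrow> u \<in> I"
proof -
  obtain m where m: "minimal S m" "m \<sqsubset> y"
    using ex_minimal_below[of S x] S(1) xyz below_trans unfolding generic_def by blast
  let ?I = "twin_block S z m"
  have int: "interval S ?I" by (rule twin_block_interval[OF S xyz(3)])
  have mt: "m \<in> twins S z m" using m below_trans xyz(5) unfolding twins_def by blast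
  have mI: "m \<in> ?I" using mt unfolding twin_block_def twins_def minimal_def by blast
  have yI: "y \<in> ?I" using mt m xyz unfolding twin_block_def by blast
  have zI: "z \<notin> ?I" unfolding twin_block_def below_def by simp
  have ne: "m \<noteq> y" using m unfolding below_def by auto
  have down: "u \<in> ?I" if u: "u \<in> S" "c \<in> ?I" "u \<sqsubset> c" for u c
  proof (rule ccontr)
    assume uI: "u \<notin> ?I"
    have ms: "m \<in> S" "\<not> u \<sqsubset> m" using m u unfolding minimal_def by auto
    have um: "u \<noteq> m" using uI mI by blast
    have "p m < p u \<or> v m < v u"
      using generic_less_cases[OF S(1) u(1) ms(1) um] ms(2) unfolding below_def by blast
    moreover have "p u < p c" "v u < v c" using u(3) unfolding below_def by auto
    ultimately show False using intervalD[OF int mI u(2) u(1)] uI by blast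
  qed
  show thesis by (rule that[OF int zI mI yI ne down])
qed

section \<open>Colouring\<close>

text \<open>
  An occurrence of 463152, listed by position. The letters reflect that \<open>m1\<close>, \<open>m2\<close>, \<open>m3\<close> (playing 4, 3, 1)
  are the left-to-right minima of the pattern and \<open>y1\<close>, \<open>y2\<close>, \<open>y3\<close> (playing 6, 5, 2) its other points.
\<close>

definition copy :: "'a \<Rightarrow> 'a \<Rightarrow> 'a \<Rightarrow> 'a \<Rightarrow> 'a \<Rightarrow> 'a \<Rightarrow> bool" where
  "copy m1 y1 m2 m3 y2 y3 \<longleftrightarrow>
     p m1 < p y1 \<and> p y1 < p m2 \<and> p m2 < p m3 \<and> p m3 < p y2 \<and> p y2 < p y3 \<and>
     v m3 < v y3 \<and> v y3 < v m2 \<and> v m2 < v m1 \<and> v m1 < v y2 \<and> v y2 < v y1"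

lemma copy_below:
  assumes "copy m1 y1 m2 m3 y2 y3"
  shows "m1 \<sqsubset> y1 \<and> m1 \<sqsubset> y2 \<and> m2 \<sqsubset> y2 \<and> m3 \<sqsubset> y2 \<and> m3 \<sqsubset> y3"
  using assms unfolding copy_def below_def by (elim conjE, intro conjI; order)

text \<open>
  Letting minima of \<open>S\<close> count as having every colour is what makes the induction work: when an
  interval is shrunk to a minimum \<open>q\<close>, the colour of \<open>q\<close> must not matter, since both colours may
  occur inside the interval.
\<close>

definition bad_copy :: "'a set \<Rightarrow> ('a \<Rightarrow> bool) \<Rightarrow> 'a \<Rightarrow> 'a \<Rightarrow> 'a \<Rightarrow> 'a \<Rightarrow> 'a \<Rightarrow> 'a \<Rightarrow> bool" where
  "bad_copy S col m1 y1 m2 m3 y2 y3 \<longleftrightarrow>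
     {m1, y1, m2, m3, y2, y3} \<subseteq> S \<and> copy m1 y1 m2 m3 y2 y3 \<and> col y1 = col y2 \<and> col y2 = col y3 \<and>
     (\<forall>m\<in>{m1, m2, m3}. col m = col y1 \<or> minimal S m)"

text \<open>
  The first two conditions are what the colouring needs: a group has a common lower bound, and points
  with a common lower bound are at most one group apart. The third one, on the points that share a
  lower bound with the leftmost point, is there for the induction: it bounds how far the points
  sharing a lower bound with a newly added first group can reach.
\<close>

definition grouping :: "'a set \<Rightarrow> 'a set \<Rightarrow> ('a \<Rightarrow> nat) \<Rightarrow> bool" where
  "grouping S Y h \<longleftrightarrow>
     (\<forall>y\<in>Y. \<exists>q\<in>S. \<forall>y'\<in>Y. h y' = h y \<longrightarrow> q \<sqsubset> y') \<and>
     (\<forall>y\<in>Y. \<forall>y'\<in>Y. \<forall>m\<in>S. m \<sqsubset> y \<and> m \<sqsubset> y' \<longrightarrow> h y \<le> h y' + 1) \<and>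
     (\<forall>y0\<in>Y. (\<forall>y\<in>Y. p y0 \<le> p y) \<longrightarrow> (\<forall>y\<in>Y. \<forall>m\<in>S. m \<sqsubset> y0 \<and> m \<sqsubset> y \<longrightarrow> h y = 0))"

text \<open>
  Greedy choice: the first group consists of the points above \<open>q\<close>, the rightmost (hence lowest) point
  below the leftmost point \<open>y0\<close>, and the remaining points are grouped recursively. As \<open>Y\<close> is
  decreasing, a lower bound shared by a point of the first group and a remaining point is also below
  the leftmost remaining point, so the latter point is in the second group.
\<close>

lemma ex_grouping:
  assumes S: "generic S" and no123: "\<And>x y z. x \<in> S \<Longrightarrow> y \<in> S \<Longrightarrow> z \<in> S \<Longrightarrow> x \<sqsubset> y \<Longrightarrow> \<not> y \<sqsubset> z"
    and Y: "finite Y" "\<And>y. y \<in> Y \<Longrightarrow> y \<in> S \<and> (\<exists>m\<in>S. m \<sqsubset> y)"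
  shows "\<exists>h. grouping S Y h"
  using Y
proof (induction Y rule: finite_psubset_induct)
  case (psubset Y)
  note YS = psubset.prems
  show ?case
  proof (cases "Y = {}")
    case True
    thus ?thesis unfolding grouping_def by simp
  next
    case False
    then obtain y0 where y0: "y0 \<in> Y" "\<And>y. y \<in> Y \<Longrightarrow> p y0 \<le> p y"
      using ex_leftmost[OF psubset.hyps(1)] by blast
    let ?B = "{m \<in> S. m \<sqsubset> y0}"
    have "finite ?B" "?B \<noteq> {}" using S YS[OF y0(1)] unfolding generic_def by auto
    then obtain q where "q \<in> ?B" and qmax: "\<And>m. m \<in> ?B \<Longrightarrow> p m \<le> p q"
      using ex_rightmost by blast
    hence q: "q \<in> S" "q \<sqsubset> y0" by auto
    have Y_dec: "v y' < v y" if yy': "y \<in> Y" "y' \<in> Y" "p y < p y'" for y y'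
    proof -
      obtain m where "m \<in> S" "m \<sqsubset> y" and yS: "y \<in> S" "y' \<in> S" using YS yy' by blast
      hence "\<not> y \<sqsubset> y'" using no123 by blast
      thus ?thesis using generic_less_cases(2)[OF S yS] yy'(3) unfolding below_def by auto
    qed
    have q_below: "q \<sqsubset> y" if "y \<in> Y" "m \<in> S" "m \<sqsubset> y0" "m \<sqsubset> y" for y m
    proof -
      have "v q \<le> v m"
      proof (cases "m = q")
        case False
        have "p m < p q"
          using qmax[of m] that(2,3) generic_less_cases(1)[OF S that(2) q(1) False] by auto
        moreover have "\<not> m \<sqsubset> q" using no123[OF that(2) q(1) _ _] q(2) YS[OF y0(1)] by blast
        ultimately show ?thesis unfolding below_def by auto
      qed simp
      moreover have "p q < p y" using q y0(2)[OF that(1)] unfolding below_def by auto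
      ultimately show ?thesis using that unfolding below_def by auto
    qed
    let ?Y' = "{y \<in> Y. \<not> q \<sqsubset> y}"
    have "?Y' \<subset> Y" using y0(1) q by blast
    from psubset.IH[OF this] YS obtain h where h: "grouping S ?Y' h" by blast
    have h1: "\<exists>q\<in>S. \<forall>y'\<in>?Y'. h y' = h y \<longrightarrow> q \<sqsubset> y'" if "y \<in> ?Y'" for y
      using h that unfolding grouping_def by blast
    have h2: "h y \<le> h y' + 1" if "y \<in> ?Y'" "y' \<in> ?Y'" "m \<in> S" "m \<sqsubset> y" "m \<sqsubset> y'" for y y' m
      using h that unfolding grouping_def by blast
    have h3: "h y = 0" if "y0 \<in> ?Y'" "\<forall>y\<in>?Y'. p y0 \<le> p y" "y \<in> ?Y'" "m \<in> S" "m \<sqsubset> y0" "m \<sqsubset> y"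
      for y0 y m
      using h that unfolding grouping_def by blast
    define h' where "h' y = (if q \<sqsubset> y then 0 else Suc (h y))" for y
    have next_group: "h y' = 0"
      if y: "y \<in> Y" "q \<sqsubset> y" and y': "y' \<in> ?Y'" and m: "m \<in> S" "m \<sqsubset> y" "m \<sqsubset> y'" for y y' m
    proof -
      have "finite ?Y'" using psubset.hyps(1) by simp
      then obtain y1 where y1: "y1 \<in> ?Y'" "\<And>y. y \<in> ?Y' \<Longrightarrow> p y1 \<le> p y"
        using ex_leftmost[of ?Y'] y' by blast
      have "p q < p y1" using q y0(2)[of y1] y1(1) unfolding below_def by auto
      hence "v y1 \<le> v q" using y1(1) unfolding below_def by auto
      hence "v y1 < v y" using y unfolding below_def by auto
      hence ne: "y \<noteq> y1" and "\<not> p y1 < p y" using Y_dec[of y1 y] y1(1) y(1) by auto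
      hence "p y < p y1"
        using generic_less_cases(1)[OF S _ _ ne] YS y(1) y1(1) by auto
      moreover have "v y' \<le> v y1"
      proof (cases "y' = y1")
        case False
        hence "p y1 < p y'"
          using y1(2)[OF y'] generic_less_cases(1)[OF S _ _ False] YS y' y1(1) by auto
        thus ?thesis using Y_dec[of y1 y'] y1(1) y' by auto
      qed simp
      ultimately have "m \<sqsubset> y1" using m unfolding below_def by auto
      from h3[OF y1(1) _ y' m(1) this m(3)] y1(2) show ?thesis by blast
    qed
    have "\<exists>r\<in>S. \<forall>y'\<in>Y. h' y' = h' y \<longrightarrow> r \<sqsubset> y'" if "y \<in> Y" for y
    proof (cases "q \<sqsubset> y")
      case True
      thus ?thesis using q(1) unfolding h'_def by (intro bexI[of _ q]) auto
    next
      case False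
      with that obtain r where "r \<in> S" "\<forall>y'\<in>?Y'. h y' = h y \<longrightarrow> r \<sqsubset> y'" using h1[of y] by blast
      thus ?thesis using False unfolding h'_def by (intro bexI[of _ r]) auto
    qed
    moreover have "h' y \<le> h' y' + 1" if "y \<in> Y" "y' \<in> Y" "m \<in> S" "m \<sqsubset> y" "m \<sqsubset> y'" for y y' m
      using that h2[of y y' m] next_group[of y' y m] unfolding h'_def by auto
    moreover have "h' y = 0"
      if "y1 \<in> Y" "\<forall>y\<in>Y. p y1 \<le> p y" "y \<in> Y" "m \<in> S" "m \<sqsubset> y1" "m \<sqsubset> y" for y1 y m
    proof -
      have "y1 = y0" using that y0 S YS unfolding generic_def inj_on_def by (meson order_antisym)
      thus ?thesis using q_below that unfolding h'_def by auto
    qed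
    ultimately have "grouping S Y h'" unfolding grouping_def by blast
    thus ?thesis by blast
  qed
qed

text \<open>
  Colour by the parity of the group. In a bad copy, \<open>y1, y2\<close> share \<open>m1\<close> and \<open>y2, y3\<close> share \<open>m3\<close>, so equal
  parity forces one group with a common lower bound \<open>q\<close>. Since \<open>m2\<close> is right of \<open>y1\<close> and higher than \<open>y3\<close>,
  \<open>q \<sqsubset> m2 \<sqsubset> y2\<close>.
\<close>

lemma ex_colouring_no123:
  assumes S: "generic S" and no123: "\<And>x y z. x \<in> S \<Longrightarrow> y \<in> S \<Longrightarrow> z \<in> S \<Longrightarrow> x \<sqsubset> y \<Longrightarrow> \<not> y \<sqsubset> z"
  shows "\<exists>col. \<forall>m1 y1 m2 m3 y2 y3. \<not> bad_copy S col m1 y1 m2 m3 y2 y3"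
proof -
  let ?Y = "{y \<in> S. \<exists>m\<in>S. m \<sqsubset> y}"
  have fin: "finite ?Y" using S unfolding generic_def by auto
  have "\<exists>h. grouping S ?Y h"
  proof (rule ex_grouping[OF S _ fin])
    show "\<not> y \<sqsubset> z" if "x \<in> S" "y \<in> S" "z \<in> S" "x \<sqsubset> y" for x y z
      by (rule no123[OF that])
  qed auto
  then obtain h where h: "grouping S ?Y h" by blast
  have h1: "\<exists>q\<in>S. \<forall>y'\<in>?Y. h y' = h y \<longrightarrow> q \<sqsubset> y'" if "y \<in> ?Y" for y
    using h that unfolding grouping_def by blast
  have h2: "h y \<le> h y' + 1" if "y \<in> ?Y" "y' \<in> ?Y" "m \<in> S" "m \<sqsubset> y" "m \<sqsubset> y'" for y y' m
    using h that unfolding grouping_def by blast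
  have same: "h y = h y'"
    if "y \<in> ?Y" "y' \<in> ?Y" "m \<in> S" "m \<sqsubset> y" "m \<sqsubset> y'" "even (h y) = even (h y')" for y y' m
  proof -
    have "h y \<le> h y' + 1" "h y' \<le> h y + 1" using h2[of y y' m] h2[of y' y m] that by auto
    thus ?thesis using that(6) by presburger
  qed
  have "\<not> bad_copy S (\<lambda>y. even (h y)) m1 y1 m2 m3 y2 y3" for m1 y1 m2 m3 y2 y3
  proof
    assume bad: "bad_copy S (\<lambda>y. even (h y)) m1 y1 m2 m3 y2 y3"
    hence mem: "m1 \<in> S" "m2 \<in> S" "m3 \<in> S" "y1 \<in> S" "y2 \<in> S" "y3 \<in> S"
      and par: "even (h y1) = even (h y2)" "even (h y2) = even (h y3)"
      and copy: "copy m1 y1 m2 m3 y2 y3"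
      unfolding bad_copy_def by auto
    have b: "m1 \<sqsubset> y1" "m1 \<sqsubset> y2" "m3 \<sqsubset> y2" "m3 \<sqsubset> y3" "m2 \<sqsubset> y2"
      and gap: "p y1 < p m2" "v y3 < v m2"
      using copy_below[OF copy] copy unfolding copy_def by simp_all
    have Y: "y1 \<in> ?Y" "y2 \<in> ?Y" "y3 \<in> ?Y" using mem b by auto
    have "h y1 = h y2" "h y2 = h y3"
      using same[OF Y(1,2) mem(1) b(1,2) par(1)] same[OF Y(2,3) mem(3) b(3,4) par(2)] .
    then obtain q where q: "q \<in> S" "q \<sqsubset> y1" "q \<sqsubset> y3"
      using h1[OF Y(2)] Y(1,3) by auto
    hence "q \<sqsubset> m2" using gap unfolding below_def by auto
    thus False using no123[OF q(1) mem(2,5)] b(5) by blast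
  qed
  thus ?thesis by blast
qed

text \<open>
  The pattern 463152 is a simple permutation: any two of its entries generate all of it as an
  interval. The two lists of rules record entries that lie between two given ones by position and
  by value.
\<close>

lemma copy_simple:
  assumes "interval S I" "copy m1 y1 m2 m3 y2 y3" "{m1, y1, m2, m3, y2, y3} \<subseteq> S"
    and "\<not> {m1, y1, m2, m3, y2, y3} \<subseteq> I"
    and "a \<in> I" "b \<in> I" "a \<in> {m1, y1, m2, m3, y2, y3}" "b \<in> {m1, y1, m2, m3, y2, y3}"
  shows "a = b"
proof -
  have P: "w \<in> I" if "c \<in> I" "d \<in> I" "w \<in> S" "p c < p w" "p w < p d" for c d w
    using assms(1) that unfolding interval_def by blast
  have V: "w \<in> I" if "c \<in> I" "d \<in> I" "w \<in> S" "v c < v w" "v w < v d" for c d w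
    using assms(1) that unfolding interval_def by blast
  have o: "p m1 < p y1" "p y1 < p m2" "p m2 < p m3" "p m3 < p y2" "p y2 < p y3"
     "v m3 < v y3" "v y3 < v m2" "v m2 < v m1" "v m1 < v y2" "v y2 < v y1"
    using assms(2) unfolding copy_def by auto
  have s: "m1 \<in> S" "y1 \<in> S" "m2 \<in> S" "m3 \<in> S" "y2 \<in> S" "y3 \<in> S" using assms(3) by auto
  have rules:
    "m1 \<in> I \<Longrightarrow> m2 \<in> I \<Longrightarrow> y1 \<in> I"
    "m1 \<in> I \<Longrightarrow> m3 \<in> I \<Longrightarrow> y1 \<in> I \<and> m2 \<in> I"
    "m1 \<in> I \<Longrightarrow> y2 \<in> I \<Longrightarrow> y1 \<in> I \<and> m2 \<in> I \<and> m3 \<in> I"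
    "m1 \<in> I \<Longrightarrow> y3 \<in> I \<Longrightarrow> y1 \<in> I \<and> m2 \<in> I \<and> m3 \<in> I \<and> y2 \<in> I"
    "y1 \<in> I \<Longrightarrow> m3 \<in> I \<Longrightarrow> m2 \<in> I"
    "y1 \<in> I \<Longrightarrow> y2 \<in> I \<Longrightarrow> m2 \<in> I \<and> m3 \<in> I"
    "y1 \<in> I \<Longrightarrow> y3 \<in> I \<Longrightarrow> m2 \<in> I \<and> m3 \<in> I \<and> y2 \<in> I"
    "m2 \<in> I \<Longrightarrow> y2 \<in> I \<Longrightarrow> m3 \<in> I"
    "m2 \<in> I \<Longrightarrow> y3 \<in> I \<Longrightarrow> m3 \<in> I \<and> y2 \<in> I"
    "m3 \<in> I \<Longrightarrow> y3 \<in> I \<Longrightarrow> y2 \<in> I"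
    using o s by (auto intro: P)
  have rules':
    "m3 \<in> I \<Longrightarrow> m2 \<in> I \<Longrightarrow> y3 \<in> I"
    "m3 \<in> I \<Longrightarrow> y2 \<in> I \<Longrightarrow> y3 \<in> I \<and> m2 \<in> I \<and> m1 \<in> I"
    "m2 \<in> I \<Longrightarrow> y1 \<in> I \<Longrightarrow> m1 \<in> I \<and> y2 \<in> I"
    "y3 \<in> I \<Longrightarrow> y2 \<in> I \<Longrightarrow> m2 \<in> I \<and> m1 \<in> I"
    "m1 \<in> I \<Longrightarrow> y1 \<in> I \<Longrightarrow> y2 \<in> I"
    using o s by (auto intro: V)
  have "\<not> (m1 \<in> I \<and> y1 \<in> I \<and> m2 \<in> I \<and> m3 \<in> I \<and> y2 \<in> I \<and> y3 \<in> I)" using assms(4) by simp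
  hence "\<not> (m1 \<in> I \<and> y1 \<in> I)" "\<not> (m1 \<in> I \<and> m2 \<in> I)" "\<not> (m1 \<in> I \<and> m3 \<in> I)"
    "\<not> (m1 \<in> I \<and> y2 \<in> I)" "\<not> (m1 \<in> I \<and> y3 \<in> I)" "\<not> (y1 \<in> I \<and> m2 \<in> I)"
    "\<not> (y1 \<in> I \<and> m3 \<in> I)" "\<not> (y1 \<in> I \<and> y2 \<in> I)" "\<not> (y1 \<in> I \<and> y3 \<in> I)"
    "\<not> (m2 \<in> I \<and> m3 \<in> I)" "\<not> (m2 \<in> I \<and> y2 \<in> I)" "\<not> (m2 \<in> I \<and> y3 \<in> I)"
    "\<not> (m3 \<in> I \<and> y2 \<in> I)" "\<not> (m3 \<in> I \<and> y3 \<in> I)" "\<not> (y2 \<in> I \<and> y3 \<in> I)"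
    using rules rules' by argo+
  thus ?thesis using assms(5-8) by (elim insertE emptyE) simp_all
qed

text \<open>
  Since minima are colour-blind in the definition of a bad copy and \<open>q\<close> is a minimum, replacing a
  single point of the interval in the role of some \<open>m\<close> by \<open>q\<close> keeps the copy bad.
\<close>

lemma no_bad_copy_glue:
  assumes S: "generic S" and I: "interval S I"
    and down: "\<And>u c. u \<in> S \<Longrightarrow> c \<in> I \<Longrightarrow> u \<sqsubset> c \<Longrightarrow> u \<in> I"
    and q: "minimal S q" "q \<in> I"
    and f: "\<And>m1 y1 m2 m3 y2 y3. \<not> bad_copy (insert q (S - I)) f m1 y1 m2 m3 y2 y3"
    and g: "\<And>m1 y1 m2 m3 y2 y3. \<not> bad_copy I g m1 y1 m2 m3 y2 y3"
  shows "\<not> bad_copy S (\<lambda>a. if a \<in> I then g a else f a) m1 y1 m2 m3 y2 y3"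
    (is "\<not> bad_copy S ?col _ _ _ _ _ _")
proof
  assume bad: "bad_copy S ?col m1 y1 m2 m3 y2 y3"
  let ?T = "{m1, y1, m2, m3, y2, y3}"
  have IS: "I \<subseteq> S" using interval_subset[OF I] .
  have T: "?T \<subseteq> S" and copy: "copy m1 y1 m2 m3 y2 y3"
    and cy: "?col y1 = ?col y2" "?col y2 = ?col y3"
    and cm: "\<And>m. m \<in> {m1, m2, m3} \<Longrightarrow> ?col m = ?col y1 \<or> minimal S m"
    using bad unfolding bad_copy_def by auto
  show False
  proof (cases "?T \<subseteq> I")
    case True
    have "minimal I m" if "minimal S m" "m \<in> I" for m
      using that IS unfolding minimal_def by blast
    hence "bad_copy I g m1 y1 m2 m3 y2 y3"
      using True copy cy cm[of m1] cm[of m2] cm[of m3] unfolding bad_copy_def by auto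
    thus False using g by blast
  next
    case False
    have one: "a = b" if "a \<in> I" "b \<in> I" "a \<in> ?T" "b \<in> ?T" for a b
      using copy_simple[OF I copy T False] that by blast
    define r where "r a = (if a \<in> I then q else a)" for a
    have rp: "p (r a) < p (r b)" if ab: "a \<in> ?T" "b \<in> ?T" "p a < p b" for a b
    proof -
      have S_ab: "a \<in> S" "b \<in> S" using ab T by blast+
      consider "a \<in> I" "b \<notin> I" | "a \<notin> I" "b \<in> I" | "a \<notin> I" "b \<notin> I"
        using one[OF _ _ ab(1,2)] ab(3) by blast
      thus ?thesis
      proof cases
        case 1
        thus ?thesis using interval_same_side(1)[OF S I 1(1) q(2) S_ab(2) 1(2) ab(3)]
          unfolding r_def by simp
      next
        case 2
        thus ?thesis using interval_same_side(2)[OF S I 2(2) q(2) S_ab(1) 2(1) ab(3)]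
          unfolding r_def by simp
      qed (simp add: r_def ab(3))
    qed
    have rv: "v (r a) < v (r b)" if ab: "a \<in> ?T" "b \<in> ?T" "v a < v b" for a b
    proof -
      have S_ab: "a \<in> S" "b \<in> S" using ab T by blast+
      consider "a \<in> I" "b \<notin> I" | "a \<notin> I" "b \<in> I" | "a \<notin> I" "b \<notin> I"
        using one[OF _ _ ab(1,2)] ab(3) by blast
      thus ?thesis
      proof cases
        case 1
        thus ?thesis using interval_same_side(3)[OF S I 1(1) q(2) S_ab(2) 1(2) ab(3)]
          unfolding r_def by simp
      next
        case 2
        thus ?thesis using interval_same_side(4)[OF S I 2(2) q(2) S_ab(1) 2(1) ab(3)]
          unfolding r_def by simp
      qed (simp add: r_def ab(3))
    qed
    have copy': "copy (r m1) (r y1) (r m2) (r m3) (r y2) (r y3)"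
      using copy rp rv unfolding copy_def by simp
    \<comment> \<open>A point of the copy with another one below it would, by \<open>down\<close>, bring the latter into \<open>I\<close> too.\<close>
    have y_out: "y \<notin> I" if "m \<in> ?T" "y \<in> ?T" "m \<sqsubset> y" for m y
      using down[of m y] one[of m y] that T unfolding below_def by blast
    have y: "y1 \<notin> I" "y2 \<notin> I" "y3 \<notin> I"
      using y_out[of m1 y1] y_out[of m1 y2] y_out[of m3 y3] copy_below[OF copy] by simp_all
    have "minimal (insert q (S - I)) m" if "minimal S m" "m = q \<or> m \<notin> I" for m
      using that q(1) unfolding minimal_def by blast
    hence min: "minimal (insert q (S - I)) (r m)" if "minimal S m" for m
      using that q(1) unfolding r_def by simp
    have fm: "f (r m) = f y1 \<or> minimal (insert q (S - I)) (r m)" if "m \<in> {m1, m2, m3}" for m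
    proof (cases "m \<in> I")
      case True
      thus ?thesis using min[OF q(1)] q(2) unfolding r_def by simp
    next
      case False
      thus ?thesis using min[of m] cm[OF that] y(1) unfolding r_def by auto
    qed
    have ry: "r y1 = y1" "r y2 = y2" "r y3 = y3" using y unfolding r_def by simp_all
    have "r a \<in> insert q (S - I)" if "a \<in> S" for a using that unfolding r_def by simp
    hence "{r m1, r y1, r m2, r m3, r y2, r y3} \<subseteq> insert q (S - I)" using T by blast
    moreover have "f y1 = f y2" "f y2 = f y3" using cy y by simp_all
    ultimately have "bad_copy (insert q (S - I)) f (r m1) (r y1) (r m2) (r m3) (r y2) (r y3)"
      using copy' fm unfolding bad_copy_def ry by simp
    thus False using f by blast
  qed
qed

theorem ex_colouring:
  assumes "generic S" "layered_quadrants S"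
  shows "\<exists>col. \<forall>m1 y1 m2 m3 y2 y3. \<not> bad_copy S col m1 y1 m2 m3 y2 y3"
proof -
  have "finite S" using assms unfolding generic_def by blast
  thus ?thesis using assms
  proof (induction S rule: finite_psubset_induct)
    case (psubset S)
    note S = psubset.prems
    show ?case
    proof (cases "\<exists>x\<in>S. \<exists>y\<in>S. \<exists>z\<in>S. x \<sqsubset> y \<and> y \<sqsubset> z")
      case False
      thus ?thesis using ex_colouring_no123[OF S(1)] by blast
    next
      case True
      then obtain x y z where xyz: "x \<in> S" "y \<in> S" "z \<in> S" "x \<sqsubset> y" "y \<sqsubset> z" by blast
      from ex_minimal_interval[OF S xyz] obtain I a b where
        I: "interval S I" "z \<notin> I" "a \<in> I" "b \<in> I" "a \<noteq> b"
        and down: "\<And>u c. u \<in> S \<Longrightarrow> c \<in> I \<Longrightarrow> u \<sqsubset> c \<Longrightarrow> u \<in> I"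
        by metis
      have IS: "I \<subseteq> S" using interval_subset[OF I(1)] .
      obtain q where q: "minimal S q" "q \<in> I"
        using ex_minimal_below[OF psubset.hyps(1), of a] I(3) IS down
        unfolding minimal_def by blast
      let ?S' = "insert q (S - I)"
      have "I \<subset> S" using IS I(2) xyz(3) by blast
      moreover have "?S' \<subset> S"
      proof -
        obtain e where "e \<in> I" "e \<noteq> q" using I(3-5) by metis
        hence "e \<in> S" "e \<notin> ?S'" using IS by auto
        moreover have "?S' \<subseteq> S" using IS q(2) by blast
        ultimately show ?thesis by blast
      qed
      ultimately obtain f g where
        f: "\<And>m1 y1 m2 m3 y2 y3. \<not> bad_copy ?S' f m1 y1 m2 m3 y2 y3" and
        g: "\<And>m1 y1 m2 m3 y2 y3. \<not> bad_copy I g m1 y1 m2 m3 y2 y3"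
        using psubset.IH[of ?S'] psubset.IH[of I] generic_subset[OF S(1)]
          layered_quadrants_subset[OF S(2)] by blast
      have "\<not> bad_copy S (\<lambda>a. if a \<in> I then g a else f a) m1 y1 m2 m3 y2 y3" for m1 y1 m2 m3 y2 y3
        by (rule no_bad_copy_glue[OF S(1) I(1) down q f g])
      thus ?thesis by blast
    qed
  qed
qed

end

section \<open>Pattern containment\<close>

lemma subseq_iff_indices:
  "subseq ys xs \<longleftrightarrow> (\<exists>is. sorted_wrt (<) is \<and> set is \<subseteq> {..<length xs} \<and> ys = map ((!) xs) is)"
proof -
  have "\<exists>is. sorted_wrt (<) is \<and> set is \<subseteq> {..<length xs} \<and> ys = map ((!) xs) is" if "subseq ys xs" for ys
    using that
  proof (induction ys xs rule: list_emb.induct)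
    case (list_emb_Nil ys)
    show ?case by (intro exI[of _ "[]"]) simp
  next
    case (list_emb_Cons xs ys y)
    then obtain js where "sorted_wrt (<) js" "set js \<subseteq> {..<length ys}" "xs = map ((!) ys) js" by blast
    thus ?case by (intro exI[of _ "map Suc js"]) (auto simp: sorted_wrt_map)
  next
    case (list_emb_Cons2 x y xs ys)
    then obtain js where "sorted_wrt (<) js" "set js \<subseteq> {..<length ys}" "xs = map ((!) ys) js" by blast
    thus ?case using list_emb_Cons2.hyps(1)
      by (intro exI[of _ "0 # map Suc js"]) (auto simp: sorted_wrt_map)
  qed
  moreover have "subseq (map ((!) xs) is) xs" if "sorted_wrt (<) is" "set is \<subseteq> {..<length xs}" for "is"
  proof -
    have "subseq is [0..<length xs]"
      using that by (intro sorted_subset_imp_subseq) (auto simp: atLeast0LessThan)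
    hence "subseq (map ((!) xs) is) (map ((!) xs) [0..<length xs])" by (rule subseq_map)
    thus ?thesis by (simp add: map_nth)
  qed
  ultimately show ?thesis by blast
qed

lemma contains_iff_indices:
  "contains xs s \<longleftrightarrow> (\<exists>is. sorted_wrt (<) is \<and> set is \<subseteq> {..<length xs} \<and> order_iso (map ((!) xs) is) s)"
  unfolding contains_def subseq_iff_indices by blast

lemma order_iso_sym: "order_iso xs ys \<Longrightarrow> order_iso ys xs"
  unfolding order_iso_def by simp

lemma order_iso_trans: "order_iso xs ys \<Longrightarrow> order_iso ys zs \<Longrightarrow> order_iso xs zs"
  unfolding order_iso_def by simp

lemma contains_order_iso:
  assumes "contains xs s" "order_iso xs ys"
  shows "contains ys s"
proof -
  obtain js where js: "sorted_wrt (<) js" "set js \<subseteq> {..<length xs}" "order_iso (map ((!) xs) js) s"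
    using assms(1) unfolding contains_iff_indices by blast
  have "order_iso (map ((!) ys) js) (map ((!) xs) js)"
  proof -
    have "js ! i < length xs" if "i < length js" for i using js(2) nth_mem[OF that] by auto
    thus ?thesis using assms(2) unfolding order_iso_def by simp
  qed
  hence "order_iso (map ((!) ys) js) s" using js(3) order_iso_trans by blast
  thus ?thesis using js assms(2) unfolding contains_iff_indices order_iso_def by metis
qed

lemma contains_trans:
  assumes "contains xs ys" "contains ys s"
  shows "contains xs s"
proof -
  obtain zs where zs: "subseq zs xs" "order_iso zs ys" using assms(1) unfolding contains_def by blast
  have "contains zs s" using contains_order_iso[OF assms(2) order_iso_sym[OF zs(2)]] .
  then obtain ws where ws: "subseq ws zs" "order_iso ws s" unfolding contains_def by blast
  have "subseq ws xs" using ws(1) zs(1) by (rule subseq_order.trans)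
  thus ?thesis using ws(2) unfolding contains_def by blast
qed

lemma perm_class_Av: "perm_class (Av B)"
proof -
  have "s \<in> Av B" if p: "p \<in> Av B" and s: "is_perm s" "contains p s" for p s
  proof -
    have "\<not> contains s t" if "t \<in> B" for t
      using contains_trans[OF s(2), of t] p that unfolding Av_def by auto
    thus ?thesis using s(1) unfolding Av_def by simp
  qed
  thus ?thesis unfolding perm_class_def by (auto simp: Av_def)
qed

lemma ex_standardization:
  assumes "distinct xs" "xs \<noteq> []"
  shows "\<exists>a. is_perm a \<and> order_iso xs a"
proof -
  \<comment> \<open>The rank of \<open>x\<close>, counted from 1.\<close>
  define r where "r x = card {y \<in> set xs. y \<le> x}" for x
  have mono: "r x < r y" if "x < y" "y \<in> set xs" for x y
  proof -
    have "{z \<in> set xs. z \<le> x} \<subseteq> {z \<in> set xs. z \<le> y}" "y \<notin> {z \<in> set xs. z \<le> x}" "y \<in> {z \<in> set xs. z \<le> y}"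
      using that by auto
    thus ?thesis unfolding r_def by (intro psubset_card_mono) (simp, blast)
  qed
  have iff: "r x < r y \<longleftrightarrow> x < y" if "x \<in> set xs" "y \<in> set xs" for x y
    using mono that by (metis less_asym linorder_neqE_nat less_irrefl)
  have inj: "inj_on r (set xs)"
    by (intro inj_onI) (metis iff less_irrefl linorder_neqE_nat)
  have "r ` set xs \<subseteq> {1..length xs}"
  proof safe
    fix x assume x: "x \<in> set xs"
    have "{y \<in> set xs. y \<le> x} \<noteq> {}" using x by auto
    moreover have "r x \<le> card (set xs)" unfolding r_def by (intro card_mono) auto
    ultimately show "r x \<in> {1..length xs}"
      using card_length[of xs] unfolding r_def by (auto simp: Suc_le_eq card_gt_0_iff)
  qed
  moreover have "card (r ` set xs) = length xs"
    using inj assms(1) by (simp add: card_image distinct_card)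
  ultimately have "r ` set xs = {1..length xs}" by (intro card_subset_eq) auto
  hence "is_perm (map r xs)"
    using assms inj unfolding is_perm_def by (auto simp: distinct_map Suc_le_eq)
  moreover have "order_iso xs (map r xs)" unfolding order_iso_def using iff by simp
  ultimately show ?thesis by blast
qed

lemma in_class_merge_Av:
  assumes p: "is_perm p" and "\<And>s. s \<in> B \<Longrightarrow> \<not> contains (filter P p) s \<and> \<not> contains (filter (\<lambda>x. \<not> P x) p) s"
  shows "p \<in> Av B \<odot> Av B"
proof -
  have part: "ys = [] \<or> (\<exists>a\<in>Av B. order_iso ys a)"
    if ys: "distinct ys" "\<And>s. s \<in> B \<Longrightarrow> \<not> contains ys s" for ys
  proof (cases "ys = []")
    case False
    then obtain a where a: "is_perm a" "order_iso ys a" using ex_standardization ys(1) by blast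
    have "\<not> contains a s" if "s \<in> B" for s
      using contains_order_iso[OF _ order_iso_sym[OF a(2)], of s] ys(2)[OF that] by blast
    hence "a \<in> Av B" using a(1) unfolding Av_def by simp
    thus ?thesis using a(2) by blast
  qed simp
  have dist: "distinct (filter Q p)" for Q using p unfolding is_perm_def by simp
  have "p \<in> shuffles (filter P p) (filter (\<lambda>x. \<not> P x) p)"
    by (rule partition_in_shuffles)
  moreover have "filter P p = [] \<or> (\<exists>a\<in>Av B. order_iso (filter P p) a)"
    "filter (\<lambda>x. \<not> P x) p = [] \<or> (\<exists>a\<in>Av B. order_iso (filter (\<lambda>x. \<not> P x) p) a)"
    using part[OF dist] assms(2) by blast+
  ultimately show ?thesis using p unfolding class_merge_def by blast
qed

section \<open>The splitting\<close>

abbreviation forbidden :: "nat list" where "forbidden \<equiv> [4, 6, 3, 1, 5, 2]"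

text \<open>
  If \<open>a \<sqsubset> c\<close> and \<open>b\<close> is incomparable to both, then \<open>b\<close> is up and to the left of both or down and to the
  right of both, and together with \<open>x\<close> below them this is a 1423 or a 1342, respectively.
\<close>

lemma layered_quadrants_of_Av:
  assumes "\<not> contains xs [1,4,2,3]" "\<not> contains xs [1,3,4,2]" "distinct xs"
  shows "plane.layered_quadrants id ((!) xs) {..<length xs}"
proof -
  interpret plane id "(!) xs" .
  have pat1: "\<not> (i < j \<and> j < k \<and> k < l \<and> l < length xs \<and>
      xs ! i < xs ! k \<and> xs ! k < xs ! l \<and> xs ! l < xs ! j)" for i j k l
  proof
    assume "i < j \<and> j < k \<and> k < l \<and> l < length xs \<and>
      xs ! i < xs ! k \<and> xs ! k < xs ! l \<and> xs ! l < xs ! j"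
    hence "contains xs [1,4,2,3]" unfolding contains_iff_indices
      by (intro exI[of _ "[i, j, k, l]"]) (auto simp: order_iso_def All_less_Suc numeral_eq_Suc)
    thus False using assms by blast
  qed
  have pat2: "\<not> (i < j \<and> j < k \<and> k < l \<and> l < length xs \<and>
      xs ! i < xs ! l \<and> xs ! l < xs ! j \<and> xs ! j < xs ! k)" for i j k l
  proof
    assume "i < j \<and> j < k \<and> k < l \<and> l < length xs \<and>
      xs ! i < xs ! l \<and> xs ! l < xs ! j \<and> xs ! j < xs ! k"
    hence "contains xs [1,3,4,2]" unfolding contains_iff_indices
      by (intro exI[of _ "[i, j, k, l]"]) (auto simp: order_iso_def All_less_Suc numeral_eq_Suc)
    thus False using assms by blast
  qed
  have gen: "generic {..<length xs}"
    using assms(3) unfolding generic_def by (auto simp: inj_on_nth)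
  have key: False
    if m: "x < length xs" "a < length xs" "b < length xs" "c < length xs"
      and x: "below x a" "below x b" "below x c" and i: "incomparable a b" "incomparable b c" and ac: "below a c" for x a b c
  proof -
    have "a \<noteq> b" "b \<noteq> c" using i ac unfolding incomparable_def by auto
    hence "a < b \<and> xs ! b < xs ! a \<or> b < a \<and> xs ! a < xs ! b"
      "b < c \<and> xs ! c < xs ! b \<or> c < b \<and> xs ! b < xs ! c"
      using i generic_less_cases[OF gen, of a b] generic_less_cases[OF gen, of b c] m
      unfolding incomparable_def below_def by auto
    thus False using pat1[of x b a c] pat2[of x a c b] x ac m unfolding below_def by auto
  qed
  show ?thesis unfolding layered_quadrants_def
  proof (intro ballI impI)
    fix x a b c assume *: "x \<in> {..<length xs}" "a \<in> {..<length xs}" "b \<in> {..<length xs}" "c \<in> {..<length xs}"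
      "below x a \<and> below x b \<and> below x c \<and> incomparable a b \<and> incomparable b c"
    have "incomparable b a" "incomparable c b" using * unfolding incomparable_def by auto
    thus "incomparable a c" using * key[of x a b c] key[of x c b a] unfolding incomparable_def[of a c] by auto
  qed
qed

lemma Av_subset_merge:
  "Av {[1,4,2,3], [1,3,4,2]} \<subseteq> Av {[1,4,2,3], [1,3,4,2], forbidden} \<odot> Av {[1,4,2,3], [1,3,4,2], forbidden}"
proof
  fix xs assume "xs \<in> Av {[1,4,2,3], [1,3,4,2]}"
  hence xs: "is_perm xs" "distinct xs" "\<not> contains xs [1,4,2,3]" "\<not> contains xs [1,3,4,2]"
    unfolding Av_def is_perm_def by auto
  interpret plane id "(!) xs" .
  have "generic {..<length xs}"
    using xs(2) unfolding generic_def by (auto simp: inj_on_nth)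
  from ex_colouring[OF this layered_quadrants_of_Av[OF xs(3,4,2)]]
  obtain col where col: "\<And>m1 y1 m2 m3 y2 y3. \<not> bad_copy {..<length xs} col m1 y1 m2 m3 y2 y3" by blast
  \<comment> \<open>The colouring is on positions, whereas filtering a list needs a predicate on values.\<close>
  define P where "P a \<longleftrightarrow> (\<exists>i < length xs. xs ! i = a \<and> col i)" for a
  have P: "P (xs ! i) \<longleftrightarrow> col i" if "i < length xs" for i
    using that xs(2) nth_eq_iff_index_eq unfolding P_def by metis
  have mono: "\<not> contains (filter (\<lambda>x. P x = c) xs) forbidden" for c
  proof
    assume "contains (filter (\<lambda>x. P x = c) xs) forbidden"
    then obtain ys where ys: "subseq ys (filter (\<lambda>x. P x = c) xs)" "order_iso ys forbidden"
      unfolding contains_def by blast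
    have "subseq (filter (\<lambda>x. P x = c) xs) xs" by simp
    hence "subseq ys xs" using ys(1) subseq_order.trans by blast
    then obtain js where js: "sorted_wrt (<) js" "set js \<subseteq> {..<length xs}" "ys = map ((!) xs) js"
      unfolding subseq_iff_indices by blast
    have "length js = 6" using ys(2) js(3) unfolding order_iso_def by simp
    then obtain m1 y1 m2 m3 y2 y3 where js_eq: "js = [m1, y1, m2, m3, y2, y3]"
      by (auto simp: length_Suc_conv numeral_eq_Suc)
    have "set ys \<subseteq> set (filter (\<lambda>x. P x = c) xs)" using list_emb_set[OF ys(1)] by auto
    hence c: "col i = c" if "i \<in> set js" for i using that js P by auto
    have lt: "ys ! i < ys ! j" if "i < 6" "j < 6" "forbidden ! i < forbidden ! j" for i j
      using ys(2) that unfolding order_iso_def by auto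
    \<comment> \<open>The index pairs run through the positions of 1, 2, 3, 4, 5, 6 in the pattern.\<close>
    have "copy m1 y1 m2 m3 y2 y3"
      using js(1) lt[of 3 5] lt[of 5 2] lt[of 2 0] lt[of 0 4] lt[of 4 1]
      unfolding copy_def js(3) js_eq by (simp add: numeral_eq_Suc)
    hence "bad_copy {..<length xs} col m1 y1 m2 m3 y2 y3"
      using c js(2) unfolding bad_copy_def js_eq by simp
    thus False using col by blast
  qed
  have "\<not> contains (filter Q xs) s" if "\<not> contains xs s" for s Q
    using that subseq_order.trans[OF _ subseq_filter_left] unfolding contains_def by blast
  hence "\<not> contains (filter P xs) s \<and> \<not> contains (filter (\<lambda>x. \<not> P x) xs) s"
    if "s \<in> {[1,4,2,3], [1,3,4,2], forbidden}" for s
    using that xs(3,4) mono[of True] mono[of False] by auto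
  thus "xs \<in> Av {[1,4,2,3], [1,3,4,2], forbidden} \<odot> Av {[1,4,2,3], [1,3,4,2], forbidden}"
    by (rule in_class_merge_Av[OF xs(1)])
qed

lemma forbidden_in_Av: "forbidden \<in> Av {[1,4,2,3], [1,3,4,2]}"
proof -
  have "\<forall>ys\<in>set (subseqs forbidden). \<not> order_iso ys [1,4,2,3] \<and> \<not> order_iso ys [1,3,4,2]"
    by code_simp
  hence "\<not> contains forbidden [1,4,2,3]" "\<not> contains forbidden [1,3,4,2]"
    unfolding contains_def by (simp_all only: in_set_subseqs Ball_def) blast+
  moreover have "is_perm forbidden" unfolding is_perm_def by code_simp
  ultimately show ?thesis unfolding Av_def by blast
qed

theorem corollary5p3: "splittable (Av {[1,4,2,3], [1,3,4,2]})"
proof -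
  let ?C = "Av {[1,4,2,3], [1,3,4,2]}" and ?P = "Av {[1,4,2,3], [1,3,4,2], forbidden}"
  have "contains forbidden forbidden" unfolding contains_def order_iso_def by blast
  hence "\<not> ?C \<subseteq> ?P" using forbidden_in_Av unfolding Av_def by blast
  moreover have "splitting {#?P, ?P#} ?C"
    unfolding splitting_def using perm_class_Av Av_subset_merge
    by (auto intro!: exI[of _ "[?P, ?P]"])
  ultimately show ?thesis unfolding splittable_def nontrivial_splitting_def
    by (intro exI[of _ "{#?P, ?P#}"]) simp
qed

end
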